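(* Let $N\in\mathbb{N}$, let $X_i:=[a_i,b_i]$, $i=1,\dots,N$, be $N$ different subintervals of $[0,1]$ of positive length, and let $\{0=:x_0<x_1<\cdots<x_{N-1}<x_N:=1\}$ be a partition of $[0,1]$. Let $u_i:X_i\to[0,1]$ be affine maps (not necessarily contractive) with $u_i([a_i,b_i])=[x_{i-1},x_i]$ for $i=1,\dots,N$, where $a_1=x_0$, $b_N=x_N$, $u_i(a_i)=x_{i-1}$ and $u_i(b_i)=x_i$ for all $i$ (so $u_i(b_i)=x_i=u_{i+1}(a_{i+1})$ at interior knots). Let $y_0,\dots,y_N\in\mathbb{R}$, $\mathscr{I}:=\{(x_j,y_j): j=0,1,\dots,N\}$, and $C_{\mathscr{I}}:=\{f\in C[0,1] : f(x_j)=y_j,\ j=0,1,\dots,N\}$, with the supremum metric. Suppose that $\lambda_i,S_i\in C(X_i)$, $i=1,\dots,N$, have property (S), i.e. $$S_i(a_i)=0=S_i(b_i),\quad i=1,\dots,N,$$ $$\lambda_1(x_0)=y_0,\qquad \lambda_N(x_N)=y_N,\qquad \lambda_i(b_i)=y_i=\lambda_{i+1}(a_{i+1}),\quad i=1,\dots,N-1.$$ Then the operator $\Phi$ given by $$(\Phi f)(u_i(x))=\lambda_i(x)+S_i(x)f(x),\qquad x\in X_i,\ i=1,\dots,N,$$ maps $C_{\mathscr{I}}$ into itself and is well defined. If in addition $\max\{\|S_i\|_{\infty,X_i}: i=1,\dots,N\}<1$, then $\Phi$ is contractive on $C_{\mathscr{I}}$.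
   Context: $C(X_i)$ is the space of real-valued continuous functions on $X_i$ and $C[0,1]$ that of continuous functions on $[0,1]$ with the supremum norm; $\|\cdot\|_{\infty,X_i}$ is the supremum norm on $X_i$. "Contractive" means Lipschitz with a constant $c\in[0,1)$. *)

theory Defs
  imports "HOL-Analysis.Analysis"
begin

definition affine_on :: "real set \<Rightarrow> (real \<Rightarrow> real) \<Rightarrow> bool" where
  "affine_on X u \<longleftrightarrow> (\<exists>p q. \<forall>x\<in>X. u x = p * x + q)"

definition sup_norm_on :: "real set \<Rightarrow> (real \<Rightarrow> real) \<Rightarrow> real" where
  "sup_norm_on X f = (SUP x\<in>X. \<bar>f x\<bar>)"

text \<open>
  Elements of \<^term>\<open>cfunspace\<close> are extensional: a function on the unit interval is represented by
  the total function that takes the value \<^term>\<open>undefined\<close> elsewhere.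
  The distance is the supremum distance.
\<close>

definition C01 :: "(real \<Rightarrow> real) metric" where
  "C01 = cfunspace (top_of_set {0..1}) euclidean_metric"

definition C_interp :: "nat \<Rightarrow> (nat \<Rightarrow> real) \<Rightarrow> (nat \<Rightarrow> real) \<Rightarrow> (real \<Rightarrow> real) metric" where
  "C_interp N x y = submetric C01 {f. \<forall>j\<in>{0..N}. f (x j) = y j}"

definition property_S ::
  "nat \<Rightarrow> (nat \<Rightarrow> real) \<Rightarrow> (nat \<Rightarrow> real) \<Rightarrow> (nat \<Rightarrow> real) \<Rightarrow> (nat \<Rightarrow> real) \<Rightarrow>
   (nat \<Rightarrow> real \<Rightarrow> real) \<Rightarrow> (nat \<Rightarrow> real \<Rightarrow> real) \<Rightarrow> bool" where
  "property_S N a b x y lam S \<longleftrightarrow>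
     (\<forall>i\<in>{1..N}. S i (a i) = 0 \<and> S i (b i) = 0) \<and>
     lam 1 (x 0) = y 0 \<and> lam N (x N) = y N \<and>
     (\<forall>i\<in>{1..<N}. lam i (b i) = y i \<and> lam (Suc i) (a (Suc i)) = y i)"

text \<open>
  The defining equations of the operator, as a relation between an argument \<open>f\<close> and a
  value \<open>g\<close>.  They are consistent only for suitable \<open>f\<close>, since a knot is an
  endpoint of two pieces.
\<close>

definition Phi_rel ::
  "nat \<Rightarrow> (nat \<Rightarrow> real) \<Rightarrow> (nat \<Rightarrow> real) \<Rightarrow> (nat \<Rightarrow> real \<Rightarrow> real) \<Rightarrow>
   (nat \<Rightarrow> real \<Rightarrow> real) \<Rightarrow> (nat \<Rightarrow> real \<Rightarrow> real) \<Rightarrow>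
   (real \<Rightarrow> real) \<Rightarrow> (real \<Rightarrow> real) \<Rightarrow> bool" where
  "Phi_rel N a b u lam S f g \<longleftrightarrow>
     g \<in> extensional {0..1} \<and>
     (\<forall>i\<in>{1..N}. \<forall>t\<in>{a i..b i}. g (u i t) = lam i t + S i t * f t)"

definition Phi ::
  "nat \<Rightarrow> (nat \<Rightarrow> real) \<Rightarrow> (nat \<Rightarrow> real) \<Rightarrow> (nat \<Rightarrow> real \<Rightarrow> real) \<Rightarrow>
   (nat \<Rightarrow> real \<Rightarrow> real) \<Rightarrow> (nat \<Rightarrow> real \<Rightarrow> real) \<Rightarrow>
   (real \<Rightarrow> real) \<Rightarrow> (real \<Rightarrow> real)" where
  "Phi N a b u lam S f = (THE g. Phi_rel N a b u lam S f g)"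

definition contractive_map :: "'a metric \<Rightarrow> ('a \<Rightarrow> 'a) \<Rightarrow> bool" where
  "contractive_map m F \<longleftrightarrow>
     F \<in> mspace m \<rightarrow> mspace m \<and>
     (\<exists>c. 0 \<le> c \<and> c < 1 \<and>
        (\<forall>f\<in>mspace m. \<forall>g\<in>mspace m. mdist m (F f) (F g) \<le> c * mdist m f g))"

end

theory Submission
  imports Defs
begin

text \<open>
  The equations that define \<open>\<Phi> f\<close> prescribe the value
  \<open>lam i t + S i t * f t\<close> at the point \<open>u i t\<close>.  The images of the \<open>u i\<close> are the cells
  of the partition, so every point of the unit interval receives a value, and uniqueness is
  immediate.  The only possible conflict arises at an interior knot, where two neighbouring cells
  meet.  Since an affine map onto a nondegenerate cell is injective, such a knot is reached only from
  endpoints, and there property (S) makes the term with \<open>S i\<close> vanish and gives \<open>lam i\<close> the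
  ordinate of the knot, whatever \<open>f\<close> is.  This gives consistency and the interpolation
  conditions at the same time (\<open>piecewise_prescription_consistent\<close>).

  The value is continuous because the unit interval carries the quotient topology of the
  disjoint union of the compact intervals \<open>{a i..b i}\<close>, which it receives
  through the maps \<open>u i\<close> (\<open>continuous_on_glued\<close>).

  For the contraction, \<open>\<Phi> f\<close> and \<open>\<Phi> g\<close> differ at \<open>u i t\<close> by
  \<open>S i t * (f t - g t)\<close>, so the largest of the norms of the \<open>S i\<close> is a Lipschitz
  constant.
\<close>

section \<open>Gluing functions along maps from compact sets\<close>

text \<open>
  Compatible prescriptions define a function by choosing, for each point, any preimage in any
  of the pieces.
\<close>

lemma ex1_glued:
  assumes compat: "\<And>i j s t. \<lbrakk>i \<in> I; j \<in> I; s \<in> A i; t \<in> A j; u i s = u j t\<rbrakk> \<Longrightarrow> h i s = h j t"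
    and cover: "(\<Union>i\<in>I. u i ` A i) = K"
  shows "\<exists>!g. g \<in> extensional K \<and> (\<forall>i\<in>I. \<forall>t\<in>A i. g (u i t) = h i t)"
proof (rule ex_ex1I)
  define P where "P z p \<longleftrightarrow> fst p \<in> I \<and> snd p \<in> A (fst p) \<and> u (fst p) (snd p) = z" for z p
  define g where "g = (\<lambda>z\<in>K. let p = SOME p. P z p in h (fst p) (snd p))"
  have "g (u i t) = h i t" if "i \<in> I" "t \<in> A i" for i t
  proof -
    have "P (u i t) (i, t)"
      using that by (simp add: P_def)
    then have "P (u i t) (SOME p. P (u i t) p)"
      by (rule someI)
    moreover have "u i t \<in> K"
      using that cover by blast
    ultimately show ?thesis
      using that by (auto simp: g_def Let_def P_def intro: compat)
  qed
  moreover have "g \<in> extensional K"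
    by (simp add: g_def)
  ultimately show "\<exists>g. g \<in> extensional K \<and> (\<forall>i\<in>I. \<forall>t\<in>A i. g (u i t) = h i t)"
    by blast
next
  fix g g'
  assume g: "g \<in> extensional K \<and> (\<forall>i\<in>I. \<forall>t\<in>A i. g (u i t) = h i t)"
    and g': "g' \<in> extensional K \<and> (\<forall>i\<in>I. \<forall>t\<in>A i. g' (u i t) = h i t)"
  show "g = g'"
  proof (rule extensionalityI[of _ K])
    fix z assume "z \<in> K"
    then obtain i t where "i \<in> I" "t \<in> A i" "z = u i t"
      using cover by blast
    then show "g z = g' z"
      using g g' by simp
  qed (use g g' in auto)
qed

text \<open>
  A finite family of continuous maps from compact sets is jointly a closed map, hence a quotient
  map onto its range: the preimage of a closed set under \<open>g\<close> is a finite union of continuous images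
  of compact sets.
\<close>

lemma continuous_on_glued:
  fixes u :: "'i \<Rightarrow> 'a::topological_space \<Rightarrow> 'b::t2_space"
    and h :: "'i \<Rightarrow> 'a \<Rightarrow> 'c::topological_space"
  assumes "finite I"
    and compact: "\<And>i. i \<in> I \<Longrightarrow> compact (A i)"
    and cont_u: "\<And>i. i \<in> I \<Longrightarrow> continuous_on (A i) (u i)"
    and cont_h: "\<And>i. i \<in> I \<Longrightarrow> continuous_on (A i) (h i)"
    and g: "\<And>i t. \<lbrakk>i \<in> I; t \<in> A i\<rbrakk> \<Longrightarrow> g (u i t) = h i t"
  shows "continuous_on (\<Union>i\<in>I. u i ` A i) g"
proof -
  have "\<exists>D. closed D \<and> D \<inter> (\<Union>i\<in>I. u i ` A i) = g -` C \<inter> (\<Union>i\<in>I. u i ` A i)"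
    if "closed C" for C
  proof -
    define D where "D = (\<Union>i\<in>I. u i ` (A i \<inter> h i -` C))"
    have "compact (u i ` (A i \<inter> h i -` C))" if i: "i \<in> I" for i
    proof -
      obtain B where B: "closed B" "B \<inter> A i = h i -` C \<inter> A i"
        using cont_h[OF i] \<open>closed C\<close> by (auto simp: continuous_on_closed_invariant)
      then have "compact (A i \<inter> h i -` C)"
        using compact[OF i] by (metis Int_commute compact_Int_closed)
      then show ?thesis
        using cont_u[OF i] by (meson compact_continuous_image continuous_on_subset inf_le1)
    qed
    then have "closed D"
      unfolding D_def using \<open>finite I\<close> by (intro compact_imp_closed compact_UN) auto
    moreover have "D \<inter> (\<Union>i\<in>I. u i ` A i) = g -` C \<inter> (\<Union>i\<in>I. u i ` A i)"
      by (auto simp: D_def g[symmetric])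
    ultimately show ?thesis
      by blast
  qed
  then show ?thesis
    by (auto simp: continuous_on_closed_invariant)
qed

section \<open>Affine pieces over a partition\<close>

lemma affine_on_imp_continuous_on:
  assumes "affine_on X f"
  shows "continuous_on X f"
proof -
  obtain p q where "\<And>t. t \<in> X \<Longrightarrow> f t = p * t + q"
    using assms by (auto simp: affine_on_def)
  then show ?thesis
    by (subst continuous_on_cong[OF refl]) (auto intro!: continuous_intros)
qed

lemma affine_on_imp_inj_on:
  assumes "affine_on X f" "s \<in> X" "t \<in> X" "f s \<noteq> f t"
  shows "inj_on f X"
proof -
  obtain p q where f: "\<And>t. t \<in> X \<Longrightarrow> f t = p * t + q"
    using assms(1) by (auto simp: affine_on_def)
  then have "p \<noteq> 0"
    using assms(2-4) by auto
  then show ?thesis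
    by (auto simp: inj_on_def f)
qed

lemma partition_cells_cover:
  fixes x :: "nat \<Rightarrow> real"
  assumes "N \<ge> 1" "mono_on {0..N} x"
  shows "(\<Union>i\<in>{1..N}. {x (i - 1)..x i}) = {x 0..x N}"
  using assms
proof (induction N rule: nat_induct_at_least)
  case (Suc n)
  have "(\<Union>i\<in>{1..Suc n}. {x (i - 1)..x i}) = (\<Union>i\<in>{1..n}. {x (i - 1)..x i}) \<union> {x n..x (Suc n)}"
    by (simp add: atLeastAtMostSuc_conv Un_commute)
  also have "(\<Union>i\<in>{1..n}. {x (i - 1)..x i}) = {x 0..x n}"
    using Suc.prems by (intro Suc.IH) (auto intro: mono_on_subset)
  also have "{x 0..x n} \<union> {x n..x (Suc n)} = {x 0..x (Suc n)}"
    by (intro ivl_disj_un_two_touch monotone_onD[OF Suc.prems]) auto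
  finally show ?case .
qed simp

text \<open>
  Property (S) treats the outer endpoints \<open>x 0\<close> and \<open>x N\<close> apart from the interior knots;
  as \<open>a 1 = x 0\<close> and \<open>b N = x N\<close>, the two endpoints of every piece obey the same rule.
\<close>

lemma property_S_endpoints:
  assumes "property_S N a b x y lam S" "a 1 = x 0" "b N = x N" "i \<in> {1..N}"
  shows "lam i (a i) + S i (a i) * r = y (i - 1)" "lam i (b i) + S i (b i) * r = y i"
proof -
  have "lam i (a i) = y (i - 1)"
  proof (cases "i = 1")
    case False
    then have "i - 1 \<in> {1..<N}" "Suc (i - 1) = i"
      using assms(4) by auto
    then show ?thesis
      using assms(1) unfolding property_S_def by metis
  qed (use assms in \<open>auto simp: property_S_def\<close>)
  moreover have "lam i (b i) = y i"
    using assms by (cases "i = N") (auto simp: property_S_def)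
  ultimately show "lam i (a i) + S i (a i) * r = y (i - 1)" "lam i (b i) + S i (b i) * r = y i"
    using assms(1,4) by (simp_all add: property_S_def)
qed

text \<open>
  Two different cells share at most a knot, and only if they are neighbours; by injectivity the knot
  comes from the right end of one piece and the left end of the next, where both prescriptions equal
  the ordinate of the knot.
\<close>

lemma piecewise_prescription_consistent:
  fixes x :: "nat \<Rightarrow> real" and u h :: "nat \<Rightarrow> real \<Rightarrow> real"
  assumes mono: "strict_mono_on {0..N} x"
    and ab: "\<And>i. i \<in> {1..N} \<Longrightarrow> a i < b i"
    and affine: "\<And>i. i \<in> {1..N} \<Longrightarrow> affine_on {a i..b i} (u i)"
    and image: "\<And>i. i \<in> {1..N} \<Longrightarrow> u i ` {a i..b i} = {x (i - 1)..x i}"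
    and ends: "\<And>i. i \<in> {1..N} \<Longrightarrow> u i (a i) = x (i - 1) \<and> u i (b i) = x i"
    and h_ends: "\<And>i. i \<in> {1..N} \<Longrightarrow> h i (a i) = y (i - 1) \<and> h i (b i) = y i"
    and ij: "i \<in> {1..N}" "j \<in> {1..N}"
    and st: "s \<in> {a i..b i}" "t \<in> {a j..b j}" "u i s = u j t"
  shows "h i s = h j t"
proof -
  have inj: "inj_on (u i) {a i..b i}" if "i \<in> {1..N}" for i
  proof (rule affine_on_imp_inj_on[OF affine])
    have "x (i - 1) < x i"
      using that by (intro strict_mono_onD[OF mono]) auto
    then show "u i (a i) \<noteq> u i (b i)"
      using ends[OF that] by simp
  qed (use that ab in \<open>auto simp: less_imp_le\<close>)
  have less: "h i s = h j t"
    if "i < j" and ij: "i \<in> {1..N}" "j \<in> {1..N}"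
      and st: "s \<in> {a i..b i}" "t \<in> {a j..b j}" "u i s = u j t" for i j s t
  proof -
    have "x (j - 1) \<le> u j t" "u i s \<le> x i"
      using image[OF ij(1)] image[OF ij(2)] st(1,2) by (metis atLeastAtMost_iff imageI)+
    then have le: "x (j - 1) \<le> x i"
      using st(3) by simp
    have "\<not> i < j - 1"
    proof
      assume "i < j - 1"
      then have "x i < x (j - 1)"
        using ij by (intro strict_mono_onD[OF mono]) auto
      then show False
        using le by simp
    qed
    then have j: "j - 1 = i"
      using \<open>i < j\<close> by simp
    then have knot: "u i s = u i (b i)" "u j t = u j (a j)"
      using \<open>x (j - 1) \<le> u j t\<close> \<open>u i s \<le> x i\<close> st(3) ends[OF ij(1)] ends[OF ij(2)] by auto
    have "s = b i"
      using inj_onD[OF inj[OF ij(1)] knot(1) st(1)] ab[OF ij(1)] by simp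
    moreover have "t = a j"
      using inj_onD[OF inj[OF ij(2)] knot(2) st(2)] ab[OF ij(2)] by simp
    ultimately show ?thesis
      using h_ends[OF ij(1)] h_ends[OF ij(2)] j by simp
  qed
  consider "i < j" | "i = j" | "j < i"
    by linarith
  then show ?thesis
  proof cases
    case 1
    then show ?thesis
      using less ij st by blast
  next
    case 2
    then show ?thesis
      using inj[OF ij(1)] st by (auto dest: inj_onD)
  next
    case 3
    then show ?thesis
      using less[of j i t s] ij st by simp
  qed
qed

section \<open>The function space and the supremum norm\<close>

lemma mspace_C01: "mspace C01 = {f \<in> extensional {0..1}. continuous_on {0..1} f}"
proof -
  have "bounded (f ` {0..1})" if "continuous_on {0..1} f" for f :: "real \<Rightarrow> real"
    using that by (intro compact_imp_bounded compact_continuous_image) auto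
  then show ?thesis
    by (auto simp: C01_def)
qed

lemma mspace_C_interp:
  "f \<in> mspace (C_interp N x y) \<longleftrightarrow>
     f \<in> extensional {0..1} \<and> continuous_on {0..1} f \<and> (\<forall>j\<in>{0..N}. f (x j) = y j)"
  by (auto simp: C_interp_def mspace_C01)

lemma mdist_C_interp_le_iff:
  assumes "f \<in> mspace (C_interp N x y)" "g \<in> mspace (C_interp N x y)"
  shows "mdist (C_interp N x y) f g \<le> r \<longleftrightarrow> (\<forall>t\<in>{0..1}. \<bar>f t - g t\<bar> \<le> r)"
proof -
  have "f \<in> mspace C01" "g \<in> mspace C01"
    using assms by (auto simp: C_interp_def)
  then show ?thesis
    using cfunspace_mdist_le[of f "top_of_set {0..1}" euclidean_metric g r]
    by (simp add: C_interp_def C01_def dist_real_def)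
qed

lemma abs_le_sup_norm_on:
  assumes "compact X" "continuous_on X f" "t \<in> X"
  shows "\<bar>f t\<bar> \<le> sup_norm_on X f"
proof -
  have "compact ((\<lambda>t. \<bar>f t\<bar>) ` X)"
    using assms by (intro compact_continuous_image continuous_intros)
  then show ?thesis
    unfolding sup_norm_on_def using assms(3)
    by (intro cSUP_upper bounded_imp_bdd_above compact_imp_bounded)
qed

section \<open>The operator\<close>

theorem theorem11:
  fixes N :: nat
    and a b x y :: "nat \<Rightarrow> real"
    and u lam S :: "nat \<Rightarrow> real \<Rightarrow> real"
  assumes "N \<ge> 1"
    and "\<And>i. i \<in> {1..N} \<Longrightarrow> a i < b i \<and> {a i..b i} \<subseteq> {0..1}"
    and "inj_on (\<lambda>i. {a i..b i}) {1..N}"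
    and "x 0 = 0" and "x N = 1" and "strict_mono_on {0..N} x"
    and "\<And>i. i \<in> {1..N} \<Longrightarrow> u i \<in> {a i..b i} \<rightarrow> {0..1}"
    and "\<And>i. i \<in> {1..N} \<Longrightarrow> affine_on {a i..b i} (u i)"
    and "\<And>i. i \<in> {1..N} \<Longrightarrow> u i ` {a i..b i} = {x (i - 1)..x i}"
    and "a 1 = x 0" and "b N = x N"
    and "\<And>i. i \<in> {1..N} \<Longrightarrow> u i (a i) = x (i - 1) \<and> u i (b i) = x i"
    and "\<And>i. i \<in> {1..N} \<Longrightarrow> continuous_on {a i..b i} (lam i)"
    and "\<And>i. i \<in> {1..N} \<Longrightarrow> continuous_on {a i..b i} (S i)"
    and "property_S N a b x y lam S"
  shows "(\<forall>f\<in>mspace (C_interp N x y). \<exists>!g. Phi_rel N a b u lam S f g) \<and>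
         Phi N a b u lam S \<in> mspace (C_interp N x y) \<rightarrow> mspace (C_interp N x y) \<and>
         (Max ((\<lambda>i. sup_norm_on {a i..b i} (S i)) ` {1..N}) < 1 \<longrightarrow>
            contractive_map (C_interp N x y) (Phi N a b u lam S))"
proof -
  note ab = assms(2) and affine = assms(8) and image = assms(9) and ends = assms(12)
  note cont_S = assms(14)
  define h where "h f i t = lam i t + S i t * f t" for f :: "real \<Rightarrow> real" and i t
  let ?C = "C_interp N x y" and ?\<Phi> = "Phi N a b u lam S"
  have "(\<Union>i\<in>{1..N}. u i ` {a i..b i}) = (\<Union>i\<in>{1..N}. {x (i - 1)..x i})"
    by (intro SUP_cong refl image)
  also have "\<dots> = {0..1}"
    using partition_cells_cover[OF \<open>N \<ge> 1\<close> strict_mono_on_imp_mono_on[OF assms(6)]] assms(4,5) by simp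
  finally have cover: "(\<Union>i\<in>{1..N}. u i ` {a i..b i}) = {0..1}" .
  have h_ends: "h f i (a i) = y (i - 1) \<and> h f i (b i) = y i" if "i \<in> {1..N}" for f i
    unfolding h_def using property_S_endpoints[OF assms(15,10,11) that] by blast

  have ex1: "\<exists>!g. Phi_rel N a b u lam S f g" for f
    unfolding Phi_rel_def h_def[symmetric]
    by (rule ex1_glued[OF _ cover],
        rule piecewise_prescription_consistent[OF assms(6) _ affine image ends h_ends])
      (use ab in auto)
  then have "Phi_rel N a b u lam S f (?\<Phi> f)" for f
    unfolding Phi_def by (rule theI')
  then have ext: "?\<Phi> f \<in> extensional {0..1}"
    and eq: "\<And>i t. \<lbrakk>i \<in> {1..N}; t \<in> {a i..b i}\<rbrakk> \<Longrightarrow> ?\<Phi> f (u i t) = h f i t" for f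
    by (auto simp: Phi_rel_def h_def)

  have maps: "?\<Phi> \<in> mspace ?C \<rightarrow> mspace ?C"
  proof
    fix f assume f: "f \<in> mspace ?C"
    have "continuous_on {a i..b i} (h f i)" if "i \<in> {1..N}" for i
    proof -
      have "continuous_on {a i..b i} f"
        using f ab[OF that] by (auto simp: mspace_C_interp intro: continuous_on_subset)
      then show ?thesis
        unfolding h_def using assms(13)[OF that] cont_S[OF that] by (intro continuous_intros)
    qed
    then have "continuous_on (\<Union>i\<in>{1..N}. u i ` {a i..b i}) (?\<Phi> f)"
      using affine_on_imp_continuous_on[OF affine]
      by (intro continuous_on_glued[where h = "h f"] eq) simp_all
    then have "continuous_on {0..1} (?\<Phi> f)"
      by (simp only: cover)
    moreover have "?\<Phi> f (x j) = y j" if "j \<in> {0..N}" for j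
    proof (cases "j = 0")
      case True
      have "?\<Phi> f (u 1 (a 1)) = h f 1 (a 1)"
        using ab[of 1] \<open>N \<ge> 1\<close> by (intro eq) auto
      then show ?thesis
        using True ends[of 1] h_ends[of 1 f] \<open>N \<ge> 1\<close> by simp
    next
      case False
      then have j: "j \<in> {1..N}"
        using that by simp
      have "?\<Phi> f (u j (b j)) = h f j (b j)"
        using ab[OF j] j by (intro eq) auto
      then show ?thesis
        using ends[OF j] h_ends[OF j, of f] by simp
    qed
    ultimately show "?\<Phi> f \<in> mspace ?C"
      using ext by (simp add: mspace_C_interp)
  qed

  define c where "c = Max ((\<lambda>i. sup_norm_on {a i..b i} (S i)) ` {1..N})"
  have S_le: "\<bar>S i t\<bar> \<le> c" if "i \<in> {1..N}" "t \<in> {a i..b i}" for i t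
  proof -
    have "\<bar>S i t\<bar> \<le> sup_norm_on {a i..b i} (S i)"
      using cont_S that by (intro abs_le_sup_norm_on) auto
    also have "\<dots> \<le> c"
      unfolding c_def using that(1) by (intro Max_ge) auto
    finally show ?thesis .
  qed
  have "contractive_map ?C ?\<Phi>" if "c < 1"
  proof -
    have "0 \<le> c"
      using S_le[of 1 "a 1"] ab[of 1] \<open>N \<ge> 1\<close> by auto
    moreover have "mdist ?C (?\<Phi> f) (?\<Phi> g) \<le> c * mdist ?C f g"
      if fg: "f \<in> mspace ?C" "g \<in> mspace ?C" for f g
    proof -
      have "\<bar>?\<Phi> f z - ?\<Phi> g z\<bar> \<le> c * mdist ?C f g" if "z \<in> {0..1}" for z
      proof -
        have "z \<in> (\<Union>i\<in>{1..N}. u i ` {a i..b i})"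
          using that by (simp only: cover)
        then obtain i t where it: "i \<in> {1..N}" "t \<in> {a i..b i}" and z: "z = u i t"
          by blast
        have "?\<Phi> f z - ?\<Phi> g z = S i t * (f t - g t)"
          unfolding z eq[OF it] by (simp add: h_def algebra_simps)
        then have "\<bar>?\<Phi> f z - ?\<Phi> g z\<bar> = \<bar>S i t\<bar> * \<bar>f t - g t\<bar>"
          by (simp add: abs_mult)
        also have "\<dots> \<le> c * mdist ?C f g"
        proof (rule mult_mono)
          show "\<bar>f t - g t\<bar> \<le> mdist ?C f g"
            using mdist_C_interp_le_iff[OF fg, of "mdist ?C f g"] it ab[OF it(1)] by auto
        qed (use S_le[OF it] \<open>0 \<le> c\<close> in auto)
        finally show ?thesis .
      qed
      then show ?thesis
        using maps fg by (subst mdist_C_interp_le_iff) auto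
    qed
    ultimately show ?thesis
      unfolding contractive_map_def using maps \<open>c < 1\<close> by blast
  qed
  then show ?thesis
    using ex1 maps unfolding c_def by blast
qed

end
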